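(* For a Tychonoff space $X$, the following assertions are equivalent: (i) $X$ is an Ascoli space; (ii) for every subset $A$ of $X$ and each point $x\in \overline{A}$ there is an Ascoli subspace $B$ of $X$ such that $x\in B\cap \overline{A\cap B}$; (ii$'$) for every open subset $A$ of $X$ and each point $x\in \overline{A}$ there is an Ascoli subspace $B$ of $X$ such that $x\in B\cap \overline{A\cap B}$; (iii) there is a family $\mathcal{M}$ of Ascoli subspaces of $X$ such that $X$ is strongly functionally generated by $\mathcal{M}$.
   Context: All spaces are assumed to be Tychonoff. $C_k(X)$ denotes the space $C(X)$ of all continuous real-valued functions on $X$ with the compact-open topology. A subset $H\subseteq C(X)$ is equicontinuous if for every $x\in X$ and each $\varepsilon>0$ there is an open neighborhood $U$ of $x$ such that $|f(x')-f(x)|<\varepsilon$ for all $x'\in U$ and $f\in H$. A Tychonoff space $X$ is Ascoli if every compact subset $\mathcal{K}$ of $C_k(X)$ is evenly continuous, i.e. the map $X\times\mathcal{K}\ni(x,f)\mapsto f(x)$ is continuous (equivalently, every compact subset of $C_k(X)$ is equicontinuous). A space $X$ is strongly functionally generated by a family $\mathcal{M}$ of its subspaces if for every discontinuous function $f:X\to\mathbb{R}$ there is $M\in\mathcal{M}$ such that the restriction $f{\restriction}_M$ is discontinuous. Closures are taken in $X$. *)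

theory Defs
  imports "HOL-Analysis.Analysis"
begin

definition tychonoff_space :: "'a topology \<Rightarrow> bool" where
  "tychonoff_space X \<longleftrightarrow> completely_regular_space X \<and> Hausdorff_space X"

(* Functions are extensional outside the carrier, so that equality of elements
   of C(X) is equality of functions on the points of X. *)
definition continuous_functions :: "'a topology \<Rightarrow> ('a \<Rightarrow> real) set" where
  "continuous_functions X =
     {f. f \<in> extensional (topspace X) \<and> continuous_map X euclideanreal f}"

definition compact_open_topology :: "'a topology \<Rightarrow> ('a \<Rightarrow> real) topology" where
  "compact_open_topology X =
     topology_generated_by
       {{f \<in> continuous_functions X. f ` K \<subseteq> U} | K U. compactin X K \<and> open U}"

lemma topspace_compact_open_topology [simp]:
  "topspace (compact_open_topology X) = continuous_functions X"
  (is "_ = ?C")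
proof -
  have "?C = {f \<in> ?C. f ` {} \<subseteq> (UNIV :: real set)} \<and> compactin X {} \<and> open (UNIV :: real set)"
    by simp
  then have "?C \<in> {{f \<in> ?C. f ` K \<subseteq> U} | K U. compactin X K \<and> open U}"
    by blast
  then show ?thesis
    unfolding compact_open_topology_def topology_generated_by_topspace by blast
qed

definition evenly_continuous :: "'a topology \<Rightarrow> ('a \<Rightarrow> real) set \<Rightarrow> bool" where
  "evenly_continuous X \<K> \<longleftrightarrow>
     continuous_map (prod_topology X (subtopology (compact_open_topology X) \<K>))
       euclideanreal (\<lambda>(x, f). f x)"

definition ascoli_space :: "'a topology \<Rightarrow> bool" where
  "ascoli_space X \<longleftrightarrow>
     tychonoff_space X \<and>
     (\<forall>\<K>. compactin (compact_open_topology X) \<K> \<longrightarrow> evenly_continuous X \<K>)"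

definition ascoli_subspace :: "'a topology \<Rightarrow> 'a set \<Rightarrow> bool" where
  "ascoli_subspace X B \<longleftrightarrow> B \<subseteq> topspace X \<and> ascoli_space (subtopology X B)"

definition strongly_functionally_generated :: "'a topology \<Rightarrow> 'a set set \<Rightarrow> bool" where
  "strongly_functionally_generated X \<M> \<longleftrightarrow>
     (\<forall>M\<in>\<M>. M \<subseteq> topspace X) \<and>
     (\<forall>f :: 'a \<Rightarrow> real. \<not> continuous_map X euclideanreal f \<longrightarrow>
        (\<exists>M\<in>\<M>. \<not> continuous_map (subtopology X M) euclideanreal f))"

end

theory Submission
  imports Defs
begin

text \<open>On a compact set of functions even continuity is the same as equicontinuity (tube lemma), and
  restriction to a subspace maps compact sets to compact sets, so a compact set \<open>\<K>\<close> is
  equicontinuous on every Ascoli subspace. If \<open>\<K>\<close> fails to be equicontinuous at \<open>x\<close> for some \<open>e\<close>,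
  then \<open>x\<close> lies in the closure of the open set of all \<open>y\<close> with \<open>\<bar>f y - f x\<bar> > e / 2\<close> for some
  \<open>f \<in> \<K>\<close>, but it is not in the closure of the trace of this set on any Ascoli subspace containing \<open>x\<close>.
  For functional generation, the test function is \<open>y \<mapsto> sup {\<bar>f y - f x\<bar> | f \<in> \<K>}\<close>: it is continuous
  on each Ascoli subspace, and its continuity at \<open>x\<close> is equicontinuity of \<open>\<K>\<close> at \<open>x\<close>.\<close>

text \<open>The members of \<open>\<K>\<close> are arbitrary functions, so the same
  \<open>\<K>\<close> can be tested on a subspace of \<open>X\<close> without first restricting
  them.\<close>

definition equicontinuous :: "'a topology \<Rightarrow> ('a \<Rightarrow> real) set \<Rightarrow> bool" where
  "equicontinuous X \<K> \<longleftrightarrow>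
     (\<forall>x\<in>topspace X. \<forall>e>0. \<exists>U. openin X U \<and> x \<in> U \<and> (\<forall>y\<in>U. \<forall>f\<in>\<K>. \<bar>f y - f x\<bar> < e))"

lemma continuous_map_realI:
  fixes f :: "'a \<Rightarrow> real"
  assumes "\<And>x e. x \<in> topspace X \<Longrightarrow> e > 0 \<Longrightarrow> \<exists>U. openin X U \<and> x \<in> U \<and> (\<forall>y\<in>U. \<bar>f y - f x\<bar> < e)"
  shows "continuous_map X euclideanreal f"
  unfolding continuous_map_def
proof (intro conjI allI impI)
  fix V :: "real set"
  assume "openin euclideanreal V"
  then have V: "open V" by simp
  show "openin X {x \<in> topspace X. f x \<in> V}"
  proof (subst openin_subopen, clarify)
    fix x assume x: "x \<in> topspace X" "f x \<in> V"
    then obtain e where "e > 0" and e: "\<And>r. \<bar>r - f x\<bar> < e \<Longrightarrow> r \<in> V"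
      using V by (metis open_real)
    then obtain U where "openin X U" "x \<in> U" "\<forall>y\<in>U. \<bar>f y - f x\<bar> < e"
      using assms x by meson
    with e show "\<exists>T. openin X T \<and> x \<in> T \<and> T \<subseteq> {x \<in> topspace X. f x \<in> V}"
      using openin_subset by blast
  qed
qed auto

section \<open>Evaluation and restriction in the compact-open topology\<close>

lemma openin_compact_open_topology:
  assumes "compactin X K" "open U"
  shows "openin (compact_open_topology X) {f \<in> continuous_functions X. f ` K \<subseteq> U}"
  unfolding compact_open_topology_def using assms by (intro topology_generated_by_Basis) blast

lemma continuous_map_evaluation:
  assumes "x \<in> topspace X"
  shows "continuous_map (compact_open_topology X) euclideanreal (\<lambda>f. f x)"
  unfolding continuous_map_def
proof (intro conjI allI impI)
  fix U :: "real set"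
  assume "openin euclideanreal U"
  \<comment> \<open>Evaluation at \<open>x\<close> pulls \<open>U\<close> back to the subbasic set
    given by the compact set \<open>{x}\<close>.\<close>
  then have "openin (compact_open_topology X) {f \<in> continuous_functions X. f ` {x} \<subseteq> U}"
    using assms by (intro openin_compact_open_topology) auto
  then show "openin (compact_open_topology X) {f \<in> topspace (compact_open_topology X). f x \<in> U}"
    by simp
qed auto

text \<open>A compact set of the subspace is compact in \<open>X\<close>, so the preimage of a
  subbasic set is the subbasic set given by the same \<open>K\<close> and \<open>U\<close>. Applying
  \<open>restrict\<close> makes the image extensional on \<open>B\<close>, as membership in the
  function space of the subspace demands.\<close>

lemma continuous_map_restriction:
  assumes "B \<subseteq> topspace X"
  shows "continuous_map (compact_open_topology X) (compact_open_topology (subtopology X B))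
           (\<lambda>f. restrict f B)"
proof -
  have restr: "restrict f B \<in> continuous_functions (subtopology X B)"
    if "f \<in> continuous_functions X" for f
  proof -
    have "continuous_map (subtopology X B) euclideanreal f"
      using that by (auto simp: continuous_functions_def continuous_map_from_subtopology)
    then have "continuous_map (subtopology X B) euclideanreal (restrict f B)"
      by (rule continuous_map_eq) auto
    then show ?thesis
      using assms by (auto simp: continuous_functions_def Int_absorb1)
  qed
  show ?thesis
    unfolding compact_open_topology_def[of "subtopology X B"]
  proof (rule continuous_on_generated_topo)
    fix W
    assume "W \<in> {{f \<in> continuous_functions (subtopology X B). f ` K \<subseteq> U} |K U.
                   compactin (subtopology X B) K \<and> open U}"
    then obtain K U where K: "compactin X K" "K \<subseteq> B" and U: "open U"
      and W: "W = {f \<in> continuous_functions (subtopology X B). f ` K \<subseteq> U}"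
      by (auto simp: compactin_subtopology)
    have "(\<lambda>f. restrict f B) -` W \<inter> topspace (compact_open_topology X)
            = {f \<in> continuous_functions X. f ` K \<subseteq> U}"
      using restr K(2) unfolding W by (auto simp: image_subset_iff subset_iff)
    then show "openin (compact_open_topology X)
                 ((\<lambda>f. restrict f B) -` W \<inter> topspace (compact_open_topology X))"
      using openin_compact_open_topology[OF K(1) U] by simp
  next
    show "(\<lambda>f. restrict f B) ` topspace (compact_open_topology X)
            \<subseteq> \<Union> {{f \<in> continuous_functions (subtopology X B). f ` K \<subseteq> U} |K U.
                   compactin (subtopology X B) K \<and> open U}"
      using restr topspace_compact_open_topology[of "subtopology X B"]
      unfolding compact_open_topology_def[of "subtopology X B"] topology_generated_by_topspace
      by auto
  qed
qed

section \<open>Even continuity and equicontinuity of compact sets of functions\<close>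

lemma equicontinuous_imp_evenly_continuous:
  assumes "\<K> \<subseteq> continuous_functions X" and eq: "equicontinuous X \<K>"
  shows "evenly_continuous X \<K>"
  unfolding evenly_continuous_def
proof (rule continuous_map_realI, clarify)
  fix x f and e :: real
  assume "(x, f) \<in> topspace (prod_topology X (subtopology (compact_open_topology X) \<K>))"
    and "e > 0"
  then have x: "x \<in> topspace X" and f: "f \<in> \<K>" by auto
  from eq x \<open>e > 0\<close> obtain U where U: "openin X U" "x \<in> U" "\<And>y g. y \<in> U \<Longrightarrow> g \<in> \<K> \<Longrightarrow> \<bar>g y - g x\<bar> < e/2"
    unfolding equicontinuous_def by (meson half_gt_zero)
  \<comment> \<open>For \<open>g\<close> in \<open>\<K>\<close>, the neighbourhood \<open>U\<close>
    bounds \<open>g y - g x\<close> uniformly in \<open>g\<close>, and \<open>V\<close> bounds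
    \<open>g x - f x\<close>; each contributes half of \<open>e\<close>.\<close>
  define V where "V = {g \<in> continuous_functions X. g ` {x} \<subseteq> {f x - e/2 <..< f x + e/2}}"
  have "openin (compact_open_topology X) V"
    unfolding V_def using x by (intro openin_compact_open_topology) auto
  then have "openin (prod_topology X (subtopology (compact_open_topology X) \<K>)) (U \<times> (\<K> \<inter> V))"
    using U(1) by (auto simp: openin_prod_Times_iff openin_subtopology_Int2)
  moreover have "(x, f) \<in> U \<times> (\<K> \<inter> V)"
    using U(2) f assms(1) \<open>e > 0\<close> by (auto simp: V_def)
  moreover have "\<bar>g y - f x\<bar> < e" if "y \<in> U" "g \<in> \<K>" "g \<in> V" for y g
  proof -
    have "f x - e/2 < g x" "g x < f x + e/2"
      using that(3) by (auto simp: V_def)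
    then show ?thesis
      using U(3)[OF that(1,2)] by linarith
  qed
  ultimately show "\<exists>U. openin (prod_topology X (subtopology (compact_open_topology X) \<K>)) U \<and>
       (x, f) \<in> U \<and> (\<forall>z\<in>U. \<bar>(case z of (x, f) \<Rightarrow> f x) - f x\<bar> < e)"
    by (intro exI[of _ "U \<times> (\<K> \<inter> V)"]) auto
qed

text \<open>The function taking \<open>(y, f)\<close> to \<open>\<bar>f y - f x\<bar>\<close> is
  jointly continuous and vanishes on \<open>{x} \<times> \<K>\<close>. Since \<open>\<K>\<close> is
  compact, the tube lemma finds one neighbourhood of \<open>x\<close> on which it stays below
  \<open>e\<close> for all \<open>f\<close> in \<open>\<K>\<close> at once.\<close>

lemma evenly_continuous_imp_equicontinuous:
  assumes K: "compactin (compact_open_topology X) \<K>" and ev: "evenly_continuous X \<K>"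
  shows "equicontinuous X \<K>"
  unfolding equicontinuous_def
proof (intro ballI allI impI)
  fix x and e :: real
  assume x: "x \<in> topspace X" and "e > 0"
  let ?Y = "subtopology (compact_open_topology X) \<K>"
  have sub: "\<K> \<subseteq> continuous_functions X"
    using compactin_subset_topspace[OF K] by simp
  have "continuous_map ?Y euclideanreal (\<lambda>f. f x)"
    by (intro continuous_map_from_subtopology continuous_map_evaluation x)
  then have "continuous_map (prod_topology X ?Y) euclideanreal (\<lambda>z. snd z x)"
    using continuous_map_compose[OF continuous_map_snd[of X ?Y]] by (simp add: o_def)
  moreover have "continuous_map (prod_topology X ?Y) euclideanreal (\<lambda>z. snd z (fst z))"
    using ev by (simp add: evenly_continuous_def case_prod_unfold)
  ultimately have "continuous_map (prod_topology X ?Y) euclideanreal (\<lambda>z. snd z (fst z) - snd z x)"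
    by (intro continuous_map_diff)
  then have cont: "continuous_map (prod_topology X ?Y) euclideanreal (\<lambda>z. \<bar>snd z (fst z) - snd z x\<bar>)"
    by (rule continuous_map_real_abs)
  define W where "W = {z \<in> topspace (prod_topology X ?Y). \<bar>snd z (fst z) - snd z x\<bar> \<in> {..<e}}"
  have "openin (prod_topology X ?Y) W"
    unfolding W_def by (rule openin_continuous_map_preimage[OF cont]) simp
  moreover have "compactin ?Y \<K>"
    using K by (simp add: compactin_subtopology)
  moreover have "{x} \<times> \<K> \<subseteq> W"
    unfolding W_def using x sub \<open>e > 0\<close> by auto
  ultimately obtain U V where "openin X U" "x \<in> U" "\<K> \<subseteq> V" "U \<times> V \<subseteq> W"
    using tube_lemma_right[OF _ _ x] by metis
  moreover have "\<bar>f y - f x\<bar> < e" if "y \<in> U" "f \<in> \<K>" for y f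
  proof -
    have "(y, f) \<in> W"
      using that \<open>\<K> \<subseteq> V\<close> \<open>U \<times> V \<subseteq> W\<close> by blast
    then show ?thesis
      by (simp add: W_def)
  qed
  ultimately show "\<exists>U. openin X U \<and> x \<in> U \<and> (\<forall>y\<in>U. \<forall>f\<in>\<K>. \<bar>f y - f x\<bar> < e)"
    by blast
qed

lemma ascoli_space_iff_equicontinuous:
  "ascoli_space X \<longleftrightarrow>
     tychonoff_space X \<and> (\<forall>\<K>. compactin (compact_open_topology X) \<K> \<longrightarrow> equicontinuous X \<K>)"
proof -
  have "evenly_continuous X \<K> \<longleftrightarrow> equicontinuous X \<K>"
    if "compactin (compact_open_topology X) \<K>" for \<K>
    using equicontinuous_imp_evenly_continuous evenly_continuous_imp_equicontinuous[OF that]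
      compactin_subset_topspace[OF that] by auto
  then show ?thesis
    by (auto simp: ascoli_space_def)
qed

lemma equicontinuous_on_ascoli_subspace:
  assumes B: "ascoli_subspace X B" and K: "compactin (compact_open_topology X) \<K>"
  shows "equicontinuous (subtopology X B) \<K>"
proof -
  have "B \<subseteq> topspace X"
    using B by (simp add: ascoli_subspace_def)
  then have "compactin (compact_open_topology (subtopology X B)) ((\<lambda>f. restrict f B) ` \<K>)"
    by (intro image_compactin[OF K] continuous_map_restriction)
  then have eq: "equicontinuous (subtopology X B) ((\<lambda>f. restrict f B) ` \<K>)"
    using B by (simp add: ascoli_subspace_def ascoli_space_iff_equicontinuous)
  show ?thesis
    unfolding equicontinuous_def
  proof (intro ballI allI impI)
    fix x and e :: real
    assume x: "x \<in> topspace (subtopology X B)" and "e > 0"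
    with eq obtain U where U: "openin (subtopology X B) U" "x \<in> U"
      "\<forall>y\<in>U. \<forall>f\<in>\<K>. \<bar>restrict f B y - restrict f B x\<bar> < e"
      unfolding equicontinuous_def by (metis (no_types, lifting) imageI)
    \<comment> \<open>Inside \<open>B\<close> the restricted functions agree with the original ones,
      so the estimate passes to \<open>\<K>\<close> itself.\<close>
    moreover have "U \<subseteq> B"
      using openin_subset[OF U(1)] by simp
    ultimately show "\<exists>U. openin (subtopology X B) U \<and> x \<in> U \<and> (\<forall>y\<in>U. \<forall>f\<in>\<K>. \<bar>f y - f x\<bar> < e)"
      using x by (intro exI[of _ U]) (auto simp: subset_iff)
  qed
qed

section \<open>The closure condition and functional generation each imply the Ascoli
  property\<close>

lemma ascoli_space_if_closure:
  assumes X: "tychonoff_space X"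
    and ii: "\<And>A x. openin X A \<Longrightarrow> x \<in> X closure_of A \<Longrightarrow>
               \<exists>B. ascoli_subspace X B \<and> x \<in> B \<inter> X closure_of (A \<inter> B)"
  shows "ascoli_space X"
  unfolding ascoli_space_iff_equicontinuous
proof (intro conjI X allI impI)
  fix \<K> assume K: "compactin (compact_open_topology X) \<K>"
  then have cont: "continuous_map X euclideanreal f" if "f \<in> \<K>" for f
    using that compactin_subset_topspace[OF K] by (force simp: continuous_functions_def)
  show "equicontinuous X \<K>"
    unfolding equicontinuous_def
  proof (intro ballI allI impI, rule ccontr)
    fix x and e :: real
    assume x: "x \<in> topspace X" and "e > 0"
      and no: "\<nexists>U. openin X U \<and> x \<in> U \<and> (\<forall>y\<in>U. \<forall>f\<in>\<K>. \<bar>f y - f x\<bar> < e)"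
    \<comment> \<open>A strict inequality makes \<open>A\<close> open. The threshold
      \<open>e/2\<close> lies below \<open>e\<close>, so the points witnessing the failure, where
      only \<open>\<bar>f y - f x\<bar> \<ge> e\<close> is known, belong to
      \<open>A\<close>.\<close>
    define A where "A = (\<Union>f\<in>\<K>. {y \<in> topspace X. \<bar>f y - f x\<bar> \<in> {e/2<..}})"
    have "openin X {y \<in> topspace X. \<bar>f y - f x\<bar> \<in> {e/2<..}}" if "f \<in> \<K>" for f
      by (rule openin_continuous_map_preimage[where Y = euclideanreal])
        (intro continuous_map_real_abs continuous_map_diff cont[OF that] | simp)+
    then have "openin X A"
      unfolding A_def by blast
    moreover have "x \<in> X closure_of A"
      unfolding in_closure_of
    proof (intro conjI x allI impI)
      fix T assume T: "x \<in> T \<and> openin X T"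
      then obtain y f where "y \<in> T" "f \<in> \<K>" "\<not> \<bar>f y - f x\<bar> < e"
        using no by blast
      moreover have "y \<in> topspace X"
        using T \<open>y \<in> T\<close> openin_subset by blast
      ultimately show "\<exists>y. y \<in> A \<and> y \<in> T"
        using \<open>e > 0\<close> by (force simp: A_def)
    qed
    ultimately obtain B where B: "ascoli_subspace X B" "x \<in> B" and xB: "x \<in> X closure_of (A \<inter> B)"
      using ii by blast
    have "equicontinuous (subtopology X B) \<K>"
      by (rule equicontinuous_on_ascoli_subspace[OF B(1) K])
    then obtain U where U: "openin (subtopology X B) U" "x \<in> U"
      and less: "\<And>y f. y \<in> U \<Longrightarrow> f \<in> \<K> \<Longrightarrow> \<bar>f y - f x\<bar> < e/2"
      unfolding equicontinuous_def using x B(2) \<open>e > 0\<close>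
      by (metis Int_iff half_gt_zero topspace_subtopology)
    \<comment> \<open>\<open>T\<close> is a neighbourhood of \<open>x\<close> whose trace on
      \<open>B\<close> misses \<open>A\<close> by the bound \<open>e/2\<close>, against
      \<open>x\<close> being in the closure of \<open>A \<inter> B\<close>.\<close>
    then obtain T where T: "openin X T" "U = T \<inter> B"
      by (auto simp: openin_subtopology)
    then obtain y where "y \<in> A" "y \<in> B" "y \<in> T"
      using xB U(2) by (auto simp: in_closure_of)
    then show False
      using less T(2) by (force simp: A_def)
  qed
qed

text \<open>If every \<open>f\<close> in \<open>\<K>\<close> varies by less than \<open>e/2\<close>
  near \<open>z\<close>, the supremum varies by at most \<open>e/2\<close>. The base point
  \<open>x\<close> is a free parameter because the lemma is applied to subspaces that may miss
  it.\<close>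

lemma continuous_map_SUP_equicontinuous:
  assumes eq: "equicontinuous X \<K>" and "\<K> \<noteq> {}"
    and bdd: "\<And>y. y \<in> topspace X \<Longrightarrow> bdd_above ((\<lambda>f. \<bar>f y - f x\<bar>) ` \<K>)"
  shows "continuous_map X euclideanreal (\<lambda>y. SUP f\<in>\<K>. \<bar>f y - f x\<bar>)"
proof (rule continuous_map_realI)
  fix z and e :: real
  assume z: "z \<in> topspace X" and "e > 0"
  let ?g = "\<lambda>y. SUP f\<in>\<K>. \<bar>f y - f x\<bar>"
  obtain U where U: "openin X U" "z \<in> U"
    and less: "\<And>y f. y \<in> U \<Longrightarrow> f \<in> \<K> \<Longrightarrow> \<bar>f y - f z\<bar> < e/2"
    using eq z \<open>e > 0\<close> unfolding equicontinuous_def by (meson half_gt_zero)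
  have "\<bar>?g y - ?g z\<bar> < e" if y: "y \<in> U" for y
  proof -
    have "y \<in> topspace X"
      using y U(1) openin_subset by blast
    have "\<bar>f y - f x\<bar> \<le> ?g z + e/2" if "f \<in> \<K>" for f
      using less[OF y that] cSUP_upper[OF that bdd[OF z]] by linarith
    then have "?g y \<le> ?g z + e/2"
      by (intro cSUP_least \<open>\<K> \<noteq> {}\<close>)
    moreover have "\<bar>f z - f x\<bar> \<le> ?g y + e/2" if "f \<in> \<K>" for f
      using less[OF y that] cSUP_upper[OF that bdd[OF \<open>y \<in> topspace X\<close>]] by linarith
    then have "?g z \<le> ?g y + e/2"
      by (intro cSUP_least \<open>\<K> \<noteq> {}\<close>)
    ultimately show ?thesis
      using \<open>e > 0\<close> by linarith
  qed
  with U show "\<exists>U. openin X U \<and> z \<in> U \<and> (\<forall>y\<in>U. \<bar>?g y - ?g z\<bar> < e)"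
    by blast
qed

lemma ascoli_space_if_strongly_functionally_generated:
  assumes X: "tychonoff_space X"
    and asc: "\<And>M. M \<in> \<M> \<Longrightarrow> ascoli_subspace X M"
    and gen: "strongly_functionally_generated X \<M>"
  shows "ascoli_space X"
  unfolding ascoli_space_iff_equicontinuous
proof (intro conjI X allI impI)
  fix \<K> assume K: "compactin (compact_open_topology X) \<K>"
  show "equicontinuous X \<K>"
  \<comment> \<open>Comparing suprema of reals requires a nonempty index set.\<close>
  proof (cases "\<K> = {}")
    case True
    then show ?thesis
      by (auto simp: equicontinuous_def)
  next
    case False
    show ?thesis
      unfolding equicontinuous_def
    proof (intro ballI allI impI)
      fix x and e :: real
      assume x: "x \<in> topspace X" and "e > 0"
      let ?g = "\<lambda>y. SUP f\<in>\<K>. \<bar>f y - f x\<bar>"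
      \<comment> \<open>Compactness of \<open>\<K>\<close> makes the supremum finite:
        \<open>f \<mapsto> \<bar>f y - f x\<bar>\<close> is continuous on the function space, so its
        image of \<open>\<K>\<close> is compact.\<close>
      have bdd: "bdd_above ((\<lambda>f. \<bar>f y - f x\<bar>) ` \<K>)" if "y \<in> topspace X" for y
      proof -
        have "compactin euclideanreal ((\<lambda>f. \<bar>f y - f x\<bar>) ` \<K>)"
          by (intro image_compactin[OF K] continuous_map_real_abs continuous_map_diff
              continuous_map_evaluation that x)
        then show ?thesis
          by (simp add: compact_imp_bounded bounded_imp_bdd_above)
      qed
      have "continuous_map (subtopology X M) euclideanreal ?g" if "M \<in> \<M>" for M
        using continuous_map_SUP_equicontinuous[OF
            equicontinuous_on_ascoli_subspace[OF asc[OF that] K] False] bdd by simp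
      then have cont: "continuous_map X euclideanreal ?g"
        using gen unfolding strongly_functionally_generated_def by blast
      define U where "U = {y \<in> topspace X. ?g y \<in> {..<e}}"
      have "openin X U"
        unfolding U_def by (rule openin_continuous_map_preimage[OF cont]) simp
      \<comment> \<open>At \<open>y = x\<close> every term of the supremum is zero, so
        \<open>?g x = 0\<close>.\<close>
      moreover have "x \<in> U"
        using x \<open>e > 0\<close> False by (simp add: U_def)
      moreover have "\<bar>f y - f x\<bar> < e" if "y \<in> U" "f \<in> \<K>" for y f
        using that cSUP_upper[OF that(2) bdd[of y]] by (auto simp: U_def)
      ultimately show "\<exists>U. openin X U \<and> x \<in> U \<and> (\<forall>y\<in>U. \<forall>f\<in>\<K>. \<bar>f y - f x\<bar> < e)"
        by blast
    qed
  qed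
qed

theorem theorem3p5:
  fixes X :: "'a topology"
  assumes "tychonoff_space X"
  shows
    "(ascoli_space X \<longleftrightarrow>
       (\<forall>A x. A \<subseteq> topspace X \<and> x \<in> X closure_of A \<longrightarrow>
          (\<exists>B. ascoli_subspace X B \<and> x \<in> B \<inter> X closure_of (A \<inter> B)))) \<and>
     (ascoli_space X \<longleftrightarrow>
       (\<forall>A x. openin X A \<and> x \<in> X closure_of A \<longrightarrow>
          (\<exists>B. ascoli_subspace X B \<and> x \<in> B \<inter> X closure_of (A \<inter> B)))) \<and>
     (ascoli_space X \<longleftrightarrow>
       (\<exists>\<M>. (\<forall>M\<in>\<M>. ascoli_subspace X M) \<and> strongly_functionally_generated X \<M>))"
    (is "(?i \<longleftrightarrow> ?ii) \<and> (?i \<longleftrightarrow> ?ii') \<and> (?i \<longleftrightarrow> ?iii)")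
proof -
  \<comment> \<open>When \<open>X\<close> is Ascoli, the whole space serves as \<open>B\<close> for
    every \<open>A\<close> and \<open>x\<close>, and as the only member of a generating
    family.\<close>
  have whole: "ascoli_subspace X (topspace X)" if ?i
    using that by (simp add: ascoli_subspace_def)
  have "?ii" if ?i
  proof (intro allI impI)
    fix A x assume A: "A \<subseteq> topspace X \<and> x \<in> X closure_of A"
    then have "x \<in> topspace X \<inter> X closure_of (A \<inter> topspace X)"
      by (simp add: Int_absorb2 in_closure_of)
    with whole[OF that] show "\<exists>B. ascoli_subspace X B \<and> x \<in> B \<inter> X closure_of (A \<inter> B)"
      by blast
  qed
  moreover have "?ii \<Longrightarrow> ?ii'"
    using openin_subset by blast
  moreover have "?ii' \<Longrightarrow> ?i"
    using ascoli_space_if_closure[OF assms] by blast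
  moreover have "?iii" if ?i
    using whole[OF that]
    by (intro exI[of _ "{topspace X}"]) (simp add: strongly_functionally_generated_def)
  moreover have "?iii \<Longrightarrow> ?i"
    using ascoli_space_if_strongly_functionally_generated[OF assms] by blast
  ultimately show ?thesis
    by argo
qed

end
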